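(* Let $n$ and $k$ be positive integers with $k < \frac{n-2}{4}$. Let $P_3(K_n)$ be the convex hull of the characteristic vectors of the triangle free edge subsets of the complete graph $K_n$, and let $I_{K_n}$ be the vanishing ideal of this set of characteristic vectors. Then $$P_3(K_n) \subsetneq \mathrm{TH}_k(I_{K_n}).$$
   Context: Let $E$ be the edge set of the complete graph $K_n$ on $n$ vertices. A subset $S \subseteq E$ is triangle free if it does not contain all three edges of any triangle of $K_n$; its characteristic vector is $\chi_S \in \{0,1\}^E \subseteq \mathbb{R}^E$. The ideal $I_{K_n} \subseteq \mathbb{R}[x_e : e \in E]$ consists of all polynomials vanishing at every $\chi_S$ with $S$ triangle free. For an ideal $I$ of a polynomial ring $\mathbb{R}[x_1,\dots,x_N]$, a polynomial $f$ is $k$-sos mod $I$ if there are polynomials $g_1,\dots,g_m$ of degree at most $k$ with $f - \sum_{j=1}^m g_j^2 \in I$. The $k$-th theta body of $I$ is $$\mathrm{TH}_k(I) = \{x \in \mathbb{R}^N : f(x) \ge 0 \text{ for all } f \text{ of degree at most } 1 \text{ (affine linear) that are } k\text{-sos mod } I\}.$$ *)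

theory Defs
  imports "HOL-Analysis.Analysis" "HOL-Library.Poly_Mapping"
begin

section \<open>Polynomials, vanishing ideals and theta bodies\<close>

text \<open>The polynomial ring in the variables \<open>x\<^sub>i\<close>, \<open>i :: 'i\<close>, is the monoid algebra of the
  monomials \<open>'i \<Rightarrow>\<^sub>0 nat\<close> (exponent vectors); the ring operations are those of
  \<open>Poly_Mapping\<close>.\<close>

type_synonym 'i rpoly = "('i \<Rightarrow>\<^sub>0 nat) \<Rightarrow>\<^sub>0 real"

definition eval_rpoly :: "'i::finite rpoly \<Rightarrow> real ^ 'i \<Rightarrow> real" where
  "eval_rpoly p x =
     (\<Sum>m\<in>Poly_Mapping.keys p. Poly_Mapping.lookup p m * (\<Prod>i\<in>UNIV. (x $ i) ^ Poly_Mapping.lookup m i))"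

text \<open>The degree of the zero polynomial is \<open>0\<close>, so that it has degree at most \<open>k\<close> for every
  \<open>k\<close>.\<close>

definition total_degree :: "'i::finite rpoly \<Rightarrow> nat" where
  "total_degree p = Max (insert 0 ((\<lambda>m. \<Sum>i\<in>UNIV. Poly_Mapping.lookup m i) ` Poly_Mapping.keys p))"

definition vanishing_ideal :: "(real ^ 'i::finite) set \<Rightarrow> 'i rpoly set" where
  "vanishing_ideal V = {p. \<forall>x\<in>V. eval_rpoly p x = 0}"

definition sos_mod :: "nat \<Rightarrow> 'i::finite rpoly set \<Rightarrow> 'i rpoly \<Rightarrow> bool" where
  "sos_mod k I f \<longleftrightarrow>
     (\<exists>(m::nat) g. (\<forall>j<m. total_degree (g j) \<le> k) \<and> f - (\<Sum>j<m. (g j)\<^sup>2) \<in> I)"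

definition theta_body :: "nat \<Rightarrow> 'i::finite rpoly set \<Rightarrow> (real ^ 'i) set" where
  "theta_body k I = {x. \<forall>f. total_degree f \<le> 1 \<and> sos_mod k I f \<longrightarrow> eval_rpoly f x \<ge> 0}"

section \<open>Triangle free edge sets of the complete graph\<close>

text \<open>The edges of the complete graph with vertex set \<open>'v\<close>. As HOL types are nonempty, there
  must be at least two vertices, whence the class \<open>card2\<close> (finite with at least two
  elements).\<close>

typedef 'v edge = "{e :: 'v::card2 set. card e = 2}"
  morphisms endpoints Edge
proof -
  obtain e :: "'v set" where "card e = 2"
    using obtain_subset_with_card_n[OF two_le_card[where 'a = 'v]] by blast
  then show ?thesis by blast
qed

instance edge :: (card2) finite
proof
  have "finite (range (endpoints :: 'a edge \<Rightarrow> 'a set))"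
    by simp
  then show "finite (UNIV :: 'a edge set)"
    by (rule finite_imageD) (simp add: inj_on_def endpoints_inject)
qed

definition triangle_free :: "'v::card2 edge set \<Rightarrow> bool" where
  "triangle_free S \<longleftrightarrow>
     \<not> (\<exists>u v w. u \<noteq> v \<and> v \<noteq> w \<and> u \<noteq> w \<and> {{u, v}, {v, w}, {u, w}} \<subseteq> endpoints ` S)"

definition char_vec :: "'e::finite set \<Rightarrow> real ^ 'e" where
  "char_vec S = (\<chi> e. if e \<in> S then 1 else 0)"

definition triangle_free_points :: "(real ^ 'v::card2 edge) set" where
  "triangle_free_points = char_vec ` {S. triangle_free S}"

definition P3 :: "(real ^ 'v::card2 edge) set" where
  "P3 = convex hull triangle_free_points"

end

theory Submission
  imports Defs "HOL-Computational_Algebra.Polynomial"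
begin

text \<open>Cuts are triangle free. For an \<open>m\<close>-set \<open>A\<close> of vertices, averaging over the cuts given by the
  \<open>t\<close>-subsets of \<open>A\<close> yields moments that are polynomial in \<open>t\<close>; extrapolating these to the
  non-integer size \<open>t = m / 2\<close> for odd \<open>m\<close> gives a point with total weight
  \<open>m\<^sup>2 / 4 > \<lfloor>m\<^sup>2 / 4\<rfloor>\<close> on the edges inside \<open>A\<close>, which violates Mantel's bound. It lies in the
  theta body because the extrapolated expectation is nonnegative on squares of polynomials of degree
  at most \<open>2 * k\<close> in the vertex indicators (Grigoriev's knapsack bound), and \<open>m = 4 * k + 3\<close> is
  large enough for this.

  The nonnegativity is shown without representation theory, by induction on the degree. The
  minimisers of the quadratic form \<open>Q\<close> relative to the norm form a subspace invariant under
  permutations of \<open>A\<close>. If the minimum is negative, then \<open>f - f \<circ> (a b)\<close> vanishes for each minimiser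
  \<open>f\<close> and transposition \<open>(a b)\<close>: it is divisible by \<open>y\<^sub>a - y\<^sub>b\<close>, so that \<open>Q\<close> is nonnegative on it by
  the induction hypothesis for \<open>A - {a, b}\<close>. Hence \<open>f\<close> is symmetric, that is, a polynomial in the
  size \<open>t\<close>, and extrapolating its square gives a square.\<close>

section \<open>Extrapolated averages over subsets\<close>

text \<open>The value at the indicator vector of \<open>T\<close> of the multilinear polynomial with
  coefficients \<open>c\<close>. The strict degree bound makes \<open>d = 0\<close> the zero
  polynomial, a trivial start for the induction on the degree.\<close>

definition subset_sum :: "nat \<Rightarrow> ('a set \<Rightarrow> real) \<Rightarrow> 'a set \<Rightarrow> real" where
  "subset_sum d c T = (\<Sum>I | I \<subseteq> T \<and> card I < d. c I)"

text \<open>Up to the factor \<open>fact m / (m choose t)\<close>, this is the value at \<open>r\<close> of the Lagrange basis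
  polynomial for the node \<open>t\<close> among the nodes \<open>0, \<dots>, m\<close>; the weights may be negative if
  \<open>r\<close> is not an integer.\<close>

definition knapsack_weight :: "nat \<Rightarrow> real \<Rightarrow> nat \<Rightarrow> real" where
  "knapsack_weight m r t = (\<Prod>i<t. r - real i) * (\<Prod>i<m - t. real m - r - real i)"

text \<open>Unnormalised: the constant function 1 receives \<open>fact (card A)\<close>, which keeps
  the weights free of divisions.\<close>

definition knapsack_sum :: "'a set \<Rightarrow> real \<Rightarrow> ('a set \<Rightarrow> real) \<Rightarrow> real" where
  "knapsack_sum A r f = (\<Sum>T\<in>Pow A. knapsack_weight (card A) r (card T) * f T)"

section \<open>Lagrange interpolation in the subset size\<close>

lemma prod_minus_eq_fact: "(\<Prod>i<s. real s - real i) = fact s"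
proof -
  have "(\<Prod>i<s. real s - real i) = (\<Prod>i<s. real (s - i))"
    by (intro prod.cong) auto
  then show ?thesis
    by (simp add: fact_prod_rev lessThan_atLeast0)
qed

text \<open>At an integer \<open>s\<close> only the level \<open>t = s\<close> survives: for
  \<open>t > s\<close> the first product contains the factor \<open>s - s\<close>, for
  \<open>t < s\<close> the second one vanishes at \<open>i = m - s\<close>.\<close>

lemma knapsack_weight_at_nat:
  assumes "s \<le> m" "t \<le> m"
  shows "real (m choose t) * knapsack_weight m (real s) t = (if s = t then fact m else 0)"
proof (cases s t rule: linorder_cases)
  case less
  then show ?thesis by (auto simp: knapsack_weight_def)
next
  case equal
  have "(\<Prod>i<m - s. real m - real s - real i) = fact (m - s)"
    using assms(1) prod_minus_eq_fact[of "m - s"] by (simp add: of_nat_diff)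
  then have "real (m choose s) * knapsack_weight m (real s) s
      = real (m choose s) * (fact s * fact (m - s))"
    by (simp add: knapsack_weight_def prod_minus_eq_fact)
  also have "\<dots> = real (fact s * fact (m - s) * (m choose s))"
    by simp
  also have "\<dots> = fact m"
    using binomial_fact_lemma[OF assms(1)] by simp
  finally show ?thesis using equal by simp
next
  case greater
  have "(\<Prod>i<m - t. real m - real s - real i) = 0"
    by (rule prod_zero) (use greater assms in \<open>auto intro!: bexI[of _ "m - s"] simp: of_nat_diff\<close>)
  then show ?thesis using greater by (simp add: knapsack_weight_def)
qed

text \<open>Both sides are polynomials in \<open>r\<close> of degree at most \<open>m\<close>, and
  they agree at the \<open>m + 1\<close> integers from 0 to \<open>m\<close>.\<close>

lemma knapsack_weight_interpolation:
  fixes p :: "real poly"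
  assumes "degree p \<le> m"
  shows "(\<Sum>t\<le>m. real (m choose t) * knapsack_weight m r t * poly p (real t)) = fact m * poly p r"
proof -
  define W where "W t = (\<Prod>i<t. [:- real i, 1:]) * (\<Prod>i<m - t. [:real m - real i, -1:])" for t
  define q where "q = (\<Sum>t\<le>m. smult (real (m choose t) * poly p (real t)) (W t))"
  have W: "poly (W t) x = knapsack_weight m x t" for t x
    by (simp add: W_def knapsack_weight_def poly_prod algebra_simps)
  have q: "poly q x = (\<Sum>t\<le>m. real (m choose t) * knapsack_weight m x t * poly p (real t))" for x
    by (simp add: q_def poly_sum W algebra_simps)
  have deg_prod: "degree (\<Prod>i<s. [:f i, g i:]) \<le> s" for f g :: "nat \<Rightarrow> real" and s
    using degree_prod_sum_le[of "{..<s}" "\<lambda>i. [:f i, g i:]"]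
      sum_mono[of "{..<s}" "\<lambda>i. degree [:f i, g i:]" "\<lambda>_. 1"] by fastforce
  have "degree (W t) \<le> m" if "t \<le> m" for t
    unfolding W_def
    by (rule order.trans[OF degree_mult_le])
       (use deg_prod[of "\<lambda>i. - real i" "\<lambda>_. 1" t] deg_prod[of "\<lambda>i. real m - real i" "\<lambda>_. -1" "m - t"] that in linarith)
  then have degq: "degree q \<le> m"
    unfolding q_def by (intro degree_sum_le order.trans[OF degree_smult_le]) auto
  have "q = smult (fact m) p"
  proof (rule poly_eqI_degree[where A = "real ` {..m}"])
    show "poly q x = poly (smult (fact m) p) x" if x: "x \<in> real ` {..m}" for x
    proof -
      obtain s where s: "s \<le> m" "x = real s" using x by auto
      have "poly q x = (\<Sum>t\<le>m. (if s = t then fact m * poly p (real s) else 0))"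
        unfolding q s(2) by (intro sum.cong) (use s knapsack_weight_at_nat in auto)
      then show ?thesis using s by simp
    qed
  qed (use degq assms in \<open>auto simp: card_image inj_on_def\<close>)
  then show ?thesis by (metis q poly_smult)
qed

lemma sum_Pow_card:
  fixes h :: "nat \<Rightarrow> real"
  assumes "finite A"
  shows "(\<Sum>T\<in>Pow A. h (card T)) = (\<Sum>t\<le>card A. real (card A choose t) * h t)"
proof -
  have "(\<Sum>t\<le>card A. \<Sum>T\<in>{T \<in> Pow A. card T = t}. h (card T)) = (\<Sum>T\<in>Pow A. h (card T))"
    by (rule sum.group) (use assms in \<open>auto intro: card_mono\<close>)
  moreover have "(\<Sum>T\<in>{T \<in> Pow A. card T = t}. h (card T)) = real (card A choose t) * h t" for t
    using n_subsets[OF assms, of t] by (simp add: Pow_def)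
  ultimately show ?thesis by (simp only:)
qed

text \<open>Grouping the subsets by size reduces this to interpolation. It serves to normalise the
  weights, to treat symmetric squares and to compute the edge weight of the separating
  point.\<close>

lemma knapsack_sum_poly_card:
  assumes "finite A" "degree p \<le> card A" "\<And>T. T \<subseteq> A \<Longrightarrow> f T = poly p (real (card T))"
  shows "knapsack_sum A r f = fact (card A) * poly p r"
proof -
  have "knapsack_sum A r f = (\<Sum>T\<in>Pow A. knapsack_weight (card A) r (card T) * poly p (real (card T)))"
    unfolding knapsack_sum_def by (intro sum.cong) (use assms in auto)
  then show ?thesis
    using sum_Pow_card[OF assms(1), of "\<lambda>t. knapsack_weight (card A) r t * poly p (real t)"]
      knapsack_weight_interpolation[OF assms(2), of r] by (simp add: algebra_simps)
qed

section \<open>Splitting off two elements of the ground set\<close>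

lemma sum_Pow_insert:
  fixes h :: "'a set \<Rightarrow> real"
  assumes "finite B" "a \<notin> B"
  shows "(\<Sum>T\<in>Pow (insert a B). h T) = (\<Sum>T\<in>Pow B. h T) + (\<Sum>T\<in>Pow B. h (insert a T))"
proof -
  have "inj_on (insert a) (Pow B)"
    using assms(2) by (auto simp: inj_on_def)
  then show ?thesis
    unfolding Pow_insert
    by (subst sum.union_disjoint) (use assms in \<open>auto simp: sum.reindex\<close>)
qed

text \<open>The factors at \<open>i = 0\<close> of the two products are \<open>r\<close> and
  \<open>m + 2 - r\<close>; shifting the index in the remaining factors replaces \<open>r\<close> by
  \<open>r - 1\<close>.\<close>

lemma knapsack_weight_Suc:
  assumes "t \<le> m"
  shows "knapsack_weight (Suc (Suc m)) r (Suc t) = r * (real m + 2 - r) * knapsack_weight m (r - 1) t"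
proof -
  have *: "Suc (Suc m) - Suc t = Suc (m - t)" using assms by simp
  show ?thesis
    unfolding knapsack_weight_def * prod.lessThan_Suc_shift by (simp add: algebra_simps)
qed

text \<open>Sets containing both or neither of \<open>a\<close> and \<open>b\<close> are fixed by
  the transposition and contribute 0. The others come in pairs \<open>insert a T\<close>,
  \<open>insert b T\<close> with equal weights and equal squares, whence the factor 2.\<close>

lemma knapsack_sum_transpose:
  assumes "finite A" "a \<in> A" "b \<in> A" "a \<noteq> b"
  shows "knapsack_sum A r (\<lambda>T. (f T - f (Transposition.transpose a b ` T))\<^sup>2) =
    2 * r * (real (card A) - r) *
      knapsack_sum (A - {a, b}) (r - 1) (\<lambda>T. (f (insert a T) - f (insert b T))\<^sup>2)"
proof -
  define B where "B = A - {a, b}"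
  have B: "finite B" "a \<notin> B" "b \<notin> B" "A = insert a (insert b B)" "b \<notin> insert a B" "a \<notin> insert b B"
    using assms by (auto simp: B_def)
  have card: "card A = Suc (Suc (card B))"
    unfolding B(4) using B by simp
  let ?w = "\<lambda>T. knapsack_weight (card A) r (card T)"
  let ?h = "\<lambda>T. ?w T * (f T - f (Transposition.transpose a b ` T))\<^sup>2"
  have img: "Transposition.transpose a b ` T = T" if "T \<subseteq> B" for T
    using that B by (force simp: Transposition.transpose_def image_iff)
  have img': "Transposition.transpose a b ` insert a T = insert b T" "Transposition.transpose a b ` insert b T = insert a T"
     "Transposition.transpose a b ` insert a (insert b T) = insert a (insert b T)"  if "T \<subseteq> B" for T
    using img[OF that] by auto
  have *: "?h T = 0" "?h (insert a (insert b T)) = 0"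
      "?h (insert a T) + ?h (insert b T) = 2 * r * (real (card A) - r) *
         (knapsack_weight (card B) (r - 1) (card T) * (f (insert a T) - f (insert b T))\<^sup>2)"
    if T: "T \<subseteq> B" for T
  proof -
    have "finite T" "card T \<le> card B" "a \<notin> T" "b \<notin> T"
      using T B finite_subset card_mono by auto
    then have w: "?w (insert a T) = r * (real (card A) - r) * knapsack_weight (card B) (r - 1) (card T)"
      "?w (insert b T) = ?w (insert a T)"
      unfolding card by (simp_all add: knapsack_weight_Suc)
    show "?h T = 0" "?h (insert a (insert b T)) = 0"
      using img img' T by simp_all
    show "?h (insert a T) + ?h (insert b T) = 2 * r * (real (card A) - r) *
         (knapsack_weight (card B) (r - 1) (card T) * (f (insert a T) - f (insert b T))\<^sup>2)"
      unfolding img'[OF T] w power2_commute[of "f (insert b T)"] by (simp add: algebra_simps)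
  qed
  have "knapsack_sum A r (\<lambda>T. (f T - f (Transposition.transpose a b ` T))\<^sup>2) = (\<Sum>T\<in>Pow (insert a (insert b B)). ?h T)"
    unfolding knapsack_sum_def B(4) ..
  also have "\<dots> = (\<Sum>T\<in>Pow B. ?h T + ?h (insert b T) + ?h (insert a T) + ?h (insert a (insert b T)))"
    using B by (simp add: sum_Pow_insert sum.distrib)
  also have "\<dots> = (\<Sum>T\<in>Pow B. 2 * r * (real (card A) - r) *
         (knapsack_weight (card B) (r - 1) (card T) * (f (insert a T) - f (insert b T))\<^sup>2))"
  proof (intro sum.cong refl)
    fix T assume "T \<in> Pow B"
    then have "T \<subseteq> B" by simp
    show "?h T + ?h (insert b T) + ?h (insert a T) + ?h (insert a (insert b T)) =
      2 * r * (real (card A) - r) *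
         (knapsack_weight (card B) (r - 1) (card T) * (f (insert a T) - f (insert b T))\<^sup>2)"
      using *[OF \<open>T \<subseteq> B\<close>] by linarith
  qed
  finally show ?thesis
    by (simp add: knapsack_sum_def sum_distrib_left B_def)
qed

text \<open>The terms whose index contains \<open>a\<close> form a discrete derivative, of degree
  one less. In the difference of the values at \<open>insert a T\<close> and
  \<open>insert b T\<close> the common term cancels, so the degree drops.\<close>

lemma subset_sum_insert:
  assumes "finite T" "a \<notin> T"
  shows "subset_sum (Suc d) c (insert a T) = subset_sum (Suc d) c T + subset_sum d (\<lambda>I. c (insert a I)) T"
proof -
  have *: "{I. I \<subseteq> insert a T \<and> card I < Suc d} =
     {I. I \<subseteq> T \<and> card I < Suc d} \<union> insert a ` {I. I \<subseteq> T \<and> card I < d}" (is "?L = ?R")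
  proof
    show "?R \<subseteq> ?L"
      using assms by (auto simp: card_insert_if intro: finite_subset dest: finite_subset)
    show "?L \<subseteq> ?R"
    proof
      fix I assume I: "I \<in> ?L"
      then have "finite I" using assms(1) finite_subset by auto
      show "I \<in> ?R"
      proof (cases "a \<in> I")
        case True
        then have "I = insert a (I - {a})" "card (I - {a}) < d"
          using I card_Diff1_less[OF \<open>finite I\<close> True] by auto
        then show ?thesis using I by blast
      next
        case False
        then show ?thesis using I by auto
      qed
    qed
  qed
  have "inj_on (insert a) {I. I \<subseteq> T \<and> card I < d}"
    using assms(2) by (auto simp: inj_on_def)
  then show ?thesis
    unfolding subset_sum_def *
    by (subst sum.union_disjoint) (use assms in \<open>auto simp: sum.reindex\<close>)
qed

section \<open>Permutations of the ground set and symmetric coefficients\<close>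

lemma subset_sum_image:
  assumes "bij \<sigma>"
  shows "subset_sum d (\<lambda>I. c (\<sigma> ` I)) T = subset_sum d c (\<sigma> ` T)"
  unfolding subset_sum_def
proof (rule sum.reindex_bij_betw)
  have inj: "inj \<sigma>" using assms by (rule bij_is_inj)
  show "bij_betw ((`) \<sigma>) {I. I \<subseteq> T \<and> card I < d} {I. I \<subseteq> \<sigma> ` T \<and> card I < d}"
    unfolding bij_betw_def
  proof (intro conjI set_eqI iffI)
    show "inj_on ((`) \<sigma>) {I. I \<subseteq> T \<and> card I < d}"
      using inj by (simp add: inj_on_def inj_image_eq_iff)
  next
    fix J assume "J \<in> {I. I \<subseteq> \<sigma> ` T \<and> card I < d}"
    moreover then obtain I where "I \<subseteq> T" "J = \<sigma> ` I" by (auto simp: subset_image_iff)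
    moreover have "card (\<sigma> ` I) = card I" using inj card_image inj_on_subset by blast
    ultimately show "J \<in> (`) \<sigma> ` {I. I \<subseteq> T \<and> card I < d}" by auto
  next
    fix J assume "J \<in> (`) \<sigma> ` {I. I \<subseteq> T \<and> card I < d}"
    then obtain I where "I \<subseteq> T" "card I < d" "J = \<sigma> ` I" by auto
    moreover have "card (\<sigma> ` I) = card I" using inj card_image inj_on_subset by blast
    ultimately show "J \<in> {I. I \<subseteq> \<sigma> ` T \<and> card I < d}" by auto
  qed
qed

text \<open>Swapping an element of \<open>I - J\<close> with one of \<open>J - I\<close> keeps
  \<open>c I\<close> and the size, and brings \<open>I\<close> one step closer to
  \<open>J\<close>.\<close>

lemma symmetric_set_function:
  assumes "finite A" and sym: "\<And>a b I. a \<in> A \<Longrightarrow> b \<in> A \<Longrightarrow> c (Transposition.transpose a b ` I) = c I"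
    and "I \<subseteq> A" "J \<subseteq> A" "card I = card J"
  shows "c I = c J"
  using assms(3,5)
proof (induction "card (I - J)" arbitrary: I)
  case 0
  have "finite I" "finite J" using assms 0 finite_subset by auto
  then have "I = J" using 0 by (simp add: card_subset_eq)
  then show ?case by simp
next
  case (Suc n)
  have fin: "finite I" "finite J" using assms Suc finite_subset by auto
  obtain a where a: "a \<in> I" "a \<notin> J"
    using Suc(2) by (metis Diff_eq_empty_iff card.empty nat.distinct(1) subsetI)
  have "\<not> J \<subseteq> I" using a fin Suc by (metis card_subset_eq)
  then obtain b where b: "b \<in> J" "b \<notin> I" by blast
  let ?I = "Transposition.transpose a b ` I"
  have I: "?I = insert b (I - {a})"
    using a b by (force simp: Transposition.transpose_def image_iff)
  have "card (?I - J) = card ((I - J) - {a})" using b a I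
    by (intro arg_cong[where f = card]) auto
  then have "n = card (?I - J)" using a fin Suc(2) by simp
  moreover have "?I \<subseteq> A" using I Suc b assms by auto
  moreover have "card ?I = card J" using Suc by (simp add: card_image inj_on_subset[OF inj_transpose])
  ultimately have "c ?I = c J" using Suc(1) by blast
  moreover have "c ?I = c I"
    by (rule sym) (use a b Suc.prems assms(4) in auto)
  ultimately show ?case by simp
qed

text \<open>Coefficients that depend only on the size \<open>j\<close> turn the sum into a
  combination of the binomials \<open>t choose j\<close> with \<open>j \<le> d\<close>, each a
  polynomial in \<open>t = card T\<close>.\<close>

lemma symmetric_subset_sum_poly:
  assumes "finite A" and sym: "\<And>a b I. a \<in> A \<Longrightarrow> b \<in> A \<Longrightarrow> c (Transposition.transpose a b ` I) = c I"
  obtains p where "degree p \<le> d" "\<And>T. T \<subseteq> A \<Longrightarrow> subset_sum (Suc d) c T = poly p (real (card T))"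
proof -
  \<comment> \<open>For \<open>j > card A\<close> this value is unspecified, but it is then
    multiplied by \<open>t choose j = 0\<close>.\<close>
  define \<gamma> where "\<gamma> j = c (SOME I. I \<subseteq> A \<and> card I = j)" for j
  have \<gamma>: "c I = \<gamma> (card I)" if "I \<subseteq> A" for I
  proof -
    have "(SOME J. J \<subseteq> A \<and> card J = card I) \<subseteq> A \<and> card (SOME J. J \<subseteq> A \<and> card J = card I) = card I"
      by (rule someI[of _ I]) (use that in auto)
    then show ?thesis
      unfolding \<gamma>_def using symmetric_set_function[of A c, OF assms that] by auto
  qed
  define P where "P j = smult (\<gamma> j / fact j) (\<Prod>i<j. [:- real i, 1:])" for j
  have P: "poly (P j) (real t) = real (t choose j) * \<gamma> j" for j t
    by (simp add: P_def poly_prod binomial_gbinomial gbinomial_prod_rev lessThan_atLeast0)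
  have "degree (\<Prod>i<j. [:- real i, 1:]) \<le> j" for j
    using degree_prod_sum_le[of "{..<j}" "\<lambda>i. [:- real i, 1:]"] by simp
  then have degP: "degree (P j) \<le> j" for j
    unfolding P_def by (meson degree_smult_le order.trans)
  show ?thesis
  proof
    show "degree (\<Sum>j\<le>d. P j) \<le> d"
      by (rule degree_sum_le) (use degP order.trans in auto)
    fix T assume T: "T \<subseteq> A"
    then have "finite T" using assms finite_subset by auto
    have "(\<Sum>j\<le>d. \<Sum>I\<in>{I \<in> {I. I \<subseteq> T \<and> card I < Suc d}. card I = j}. c I) = subset_sum (Suc d) c T"
      unfolding subset_sum_def by (rule sum.group) (use \<open>finite T\<close> in auto)
    moreover have "(\<Sum>I\<in>{I \<in> {I. I \<subseteq> T \<and> card I < Suc d}. card I = j}. c I) = poly (P j) (real (card T))"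
      if "j \<le> d" for j
    proof -
      have "(\<Sum>I\<in>{I \<in> {I. I \<subseteq> T \<and> card I < Suc d}. card I = j}. c I) = (\<Sum>I\<in>{I. I \<subseteq> T \<and> card I = j}. \<gamma> j)"
        by (rule sum.cong) (use \<gamma> T that in auto)
      then show ?thesis using n_subsets[OF \<open>finite T\<close>, of j] P by simp
    qed
    ultimately show "subset_sum (Suc d) c T = poly (\<Sum>j\<le>d. P j) (real (card T))"
      by (simp add: poly_sum)
  qed
qed

text \<open>The hypotheses fit the induction: passing to \<open>A - {a, b}\<close> and
  \<open>r - 1\<close> lowers \<open>d\<close>, \<open>r\<close> and \<open>card A - r\<close> by
  one each. They also make the factor \<open>r * (card A - r)\<close> nonnegative.\<close>

lemma knapsack_sum_square_nonneg:
  fixes A :: "'a::finite set" and c :: "'a set \<Rightarrow> real"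
  assumes "real d \<le> r" "real d \<le> real (card A) - r"
  shows "0 \<le> knapsack_sum A r (\<lambda>T. (subset_sum d c T)\<^sup>2)"
  using assms
proof (induction d arbitrary: A r c)
  case 0
  then show ?case by (simp add: subset_sum_def knapsack_sum_def)
next
  case (Suc d)
  define Q where "Q v = knapsack_sum A r (\<lambda>T. (subset_sum (Suc d) (vec_nth v) T)\<^sup>2)" for v :: "real ^ 'a set"
  have "continuous_on (sphere 0 1) Q"
    unfolding Q_def knapsack_sum_def subset_sum_def by (intro continuous_intros)
  moreover have "sphere (0 :: real ^ 'a set) 1 \<noteq> {}" by simp
  ultimately obtain v where v: "norm v = 1" and min: "\<And>u. norm u = 1 \<Longrightarrow> Q v \<le> Q u"
    using continuous_attains_inf[OF compact_sphere] by (metis mem_sphere_0)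
  have add: "subset_sum (Suc d) (vec_nth (u + w)) T = subset_sum (Suc d) (vec_nth u) T + subset_sum (Suc d) (vec_nth w) T"
    and diff: "subset_sum (Suc d) (vec_nth (u - w)) T = subset_sum (Suc d) (vec_nth u) T - subset_sum (Suc d) (vec_nth w) T"
    and scale: "subset_sum (Suc d) (vec_nth (a *\<^sub>R u)) T = a * subset_sum (Suc d) (vec_nth u) T"
    for u w :: "real ^ 'a set" and a T
    by (simp_all add: subset_sum_def sum.distrib sum_subtractf sum_distrib_left)
  have Q_scale: "Q (a *\<^sub>R u) = a\<^sup>2 * Q u" for a u
    by (simp add: Q_def knapsack_sum_def scale power_mult_distrib sum_distrib_left algebra_simps)
  \<comment> \<open>Homogeneity carries the minimum on the sphere over to all vectors.\<close>
  have lower: "Q v * (norm u)\<^sup>2 \<le> Q u" for u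
  proof (cases "u = 0")
    case True
    then show ?thesis using Q_scale[of 0 u] by simp
  next
    case False
    then have "Q v \<le> Q ((1 / norm u) *\<^sub>R u)" by (intro min) simp
    also have "\<dots> = Q u / (norm u)\<^sup>2" using Q_scale by (simp add: power_divide)
    finally show ?thesis using False by (simp add: field_simps)
  qed
  have "0 \<le> Q v"
  proof (rule ccontr)
    assume "\<not> 0 \<le> Q v"
    then have neg: "Q v < 0" by simp
    have sym: "vec_nth v (Transposition.transpose a b ` I) = vec_nth v I" if ab: "a \<in> A" "b \<in> A" for a b I
    proof (cases "a = b")
      case False
      \<comment> \<open>Permuting coordinates preserves the norm and \<open>Q\<close>, so
        \<open>u\<close> is a second minimiser; the aim is \<open>v = u\<close>.\<close>
      define u where "u = (\<chi> I. v $ (Transposition.transpose a b ` I))"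
      have bij: "bij ((`) (Transposition.transpose a b))"
        by (rule involuntory_imp_bij) (simp add: image_image)
      have u_sum: "subset_sum (Suc d) (vec_nth u) T = subset_sum (Suc d) (vec_nth v) (Transposition.transpose a b ` T)" for T
        using subset_sum_image[of "Transposition.transpose a b" "Suc d" "vec_nth v" T]
        by (simp add: u_def vec_lambda_inverse)
      have norm_u: "norm u = norm v"
        unfolding norm_eq_sqrt_inner inner_vec_def u_def
        using sum.reindex_bij_betw[OF bij, of "\<lambda>I. v $ I \<bullet> v $ I"] by simp
      have "bij_betw ((`) (Transposition.transpose a b)) (Pow A) (Pow A)"
        by (rule bij_betw_Pow) (use ab in \<open>simp add: bij_betw_transpose_iff\<close>)
      then have Q_u: "Q u = Q v"
        unfolding Q_def knapsack_sum_def u_sum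
        by (subst sum.reindex_bij_betw[symmetric, where h = "(`) (Transposition.transpose a b)" and S = "Pow A"])
           (auto simp: card_image inj_on_subset[OF inj_transpose])
      have "Q (v + u) + Q (v - u) = 2 * Q v + 2 * Q u"
        by (simp add: Q_def knapsack_sum_def add diff sum.distrib[symmetric] sum_distrib_left
             power2_eq_square algebra_simps)
      moreover have "(norm (v + u))\<^sup>2 + (norm (v - u))\<^sup>2 = 2 * (norm v)\<^sup>2 + 2 * (norm u)\<^sup>2"
        by (simp add: power2_norm_eq_inner inner_add inner_diff inner_commute)
      then have "Q v * (norm (v + u))\<^sup>2 + Q v * (norm (v - u))\<^sup>2 = 4 * Q v"
        unfolding norm_u v by (simp add: distrib_left[symmetric])
      \<comment> \<open>Both parallelogram laws together with the bound \<open>lower\<close> for \<open>v + u\<close>.\<close>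
      ultimately have "Q (v - u) \<le> Q v * (norm (v - u))\<^sup>2"
        using lower[of "v + u"] Q_u by linarith
      moreover have "0 \<le> Q (v - u)"
      proof -
        have card: "card (A - {a, b}) = card A - 2"
          using ab False by (simp add: card_Diff_subset)
        have "card {a, b} \<le> card A" using ab by (intro card_mono) auto
        then have "2 \<le> card A" using False by simp
        have "0 \<le> knapsack_sum (A - {a, b}) (r - 1)
              (\<lambda>T. (subset_sum d (\<lambda>I. v $ (insert a I) - v $ (insert b I)) T)\<^sup>2)"
          by (rule Suc.IH) (use Suc.prems card \<open>2 \<le> card A\<close> in \<open>auto simp: of_nat_diff\<close>)
        also have "\<dots> = knapsack_sum (A - {a, b}) (r - 1)
              (\<lambda>T. (subset_sum (Suc d) (vec_nth v) (insert a T) - subset_sum (Suc d) (vec_nth v) (insert b T))\<^sup>2)"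
          unfolding knapsack_sum_def
        proof (intro sum.cong refl)
          fix T assume "T \<in> Pow (A - {a, b})"
          then have "a \<notin> T" "b \<notin> T" by auto
          then have "subset_sum (Suc d) (vec_nth v) (insert a T) - subset_sum (Suc d) (vec_nth v) (insert b T)
            = subset_sum d (\<lambda>I. v $ (insert a I) - v $ (insert b I)) T"
            by (simp add: subset_sum_insert) (simp add: subset_sum_def sum_subtractf)
          then show "knapsack_weight (card (A - {a, b})) (r - 1) (card T) * (subset_sum d (\<lambda>I. v $ insert a I - v $ insert b I) T)\<^sup>2 =
             knapsack_weight (card (A - {a, b})) (r - 1) (card T) * (subset_sum (Suc d) (vec_nth v) (insert a T) - subset_sum (Suc d) (vec_nth v) (insert b T))\<^sup>2"
            by simp
        qed
        finally have "0 \<le> 2 * r * (real (card A) - r) * \<dots>"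
          using Suc.prems by (intro mult_nonneg_nonneg) auto
        also have "\<dots> = Q (v - u)"
          unfolding Q_def diff u_sum
          by (rule knapsack_sum_transpose[symmetric]) (use ab False in auto)
        finally show ?thesis .
      qed
      \<comment> \<open>Since \<open>Q v < 0\<close>, this forces
        \<open>norm (v - u) = 0\<close>.\<close>
      ultimately have "0 \<le> Q v * (norm (v - u))\<^sup>2" by linarith
      then have "v = u" using neg by (simp add: zero_le_mult_iff)
      then show ?thesis by (metis u_def vec_lambda_beta)
    qed simp
    obtain p where p: "degree p \<le> d" "\<And>T. T \<subseteq> A \<Longrightarrow> subset_sum (Suc d) (vec_nth v) T = poly p (real (card T))"
      using symmetric_subset_sum_poly[of A "vec_nth v", OF _ sym] by auto
    have "Q v = fact (card A) * poly (p\<^sup>2) r"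
      unfolding Q_def
    proof (rule knapsack_sum_poly_card)
      \<comment> \<open>Interpolating the square needs degree at most \<open>card A\<close>; adding
        the two hypotheses gives even \<open>2 * d + 2 \<le> card A\<close>.\<close>
      have "degree (p\<^sup>2) \<le> 2 * d" using degree_power_le[of p 2] p(1) by linarith
      also have "\<dots> \<le> card A" using Suc.prems by linarith
      finally show "degree (p\<^sup>2) \<le> card A" .
    qed (use p in \<open>auto simp: poly_power\<close>)
    then have "0 \<le> Q v" by (simp add: poly_power)
    then show False using neg by simp
  qed
  then have "0 \<le> Q (\<chi> I. c I)"
    using lower[of "\<chi> I. c I"] by (meson mult_nonneg_nonneg order.trans zero_le_power2)
  then show ?case by (simp add: Q_def vec_lambda_inverse)
qed

section \<open>Evaluation of polynomials\<close>

definition eval_monomial :: "('i::finite \<Rightarrow>\<^sub>0 nat) \<Rightarrow> real ^ 'i \<Rightarrow> real" where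
  "eval_monomial m x = (\<Prod>i\<in>UNIV. (x $ i) ^ Poly_Mapping.lookup m i)"

lemma eval_rpoly_monomials:
  "eval_rpoly p x = (\<Sum>m\<in>Poly_Mapping.keys p. Poly_Mapping.lookup p m * eval_monomial m x)"
  by (simp add: eval_rpoly_def eval_monomial_def)

lemma eval_rpoly_zero: "eval_rpoly 0 x = 0"
  by (simp add: eval_rpoly_def)

lemma eval_rpoly_add: "eval_rpoly (p + q) x = eval_rpoly p x + eval_rpoly q x"
  unfolding eval_rpoly_def
  by (rule setsum_keys_plus_distrib) (simp_all add: algebra_simps)

lemma eval_rpoly_diff: "eval_rpoly (p - q) x = eval_rpoly p x - eval_rpoly q x"
  using eval_rpoly_add[of "p - q" q x] by simp

lemma eval_rpoly_sum: "eval_rpoly (sum f S) x = (\<Sum>s\<in>S. eval_rpoly (f s) x)"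
  by (induction S rule: infinite_finite_induct) (simp_all add: eval_rpoly_zero eval_rpoly_add)

lemma eval_rpoly_single: "eval_rpoly (Poly_Mapping.single m c) x = c * eval_monomial m x"
  by (simp add: eval_rpoly_monomials)

lemma eval_monomial_add: "eval_monomial (m + n) x = eval_monomial m x * eval_monomial n x"
  by (simp add: eval_monomial_def lookup_add power_add prod.distrib)

lemma sum_single_keys:
  "(\<Sum>m\<in>Poly_Mapping.keys p. Poly_Mapping.single m (Poly_Mapping.lookup p m)) = p"
  by (rule poly_mapping_eqI) (simp add: lookup_sum lookup_single when_def in_keys_iff)

lemma eval_rpoly_mult: "eval_rpoly (p * q) x = eval_rpoly p x * eval_rpoly q x"
proof -
  have "p * q = (\<Sum>m\<in>Poly_Mapping.keys p. \<Sum>n\<in>Poly_Mapping.keys q.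
      Poly_Mapping.single (m + n) (Poly_Mapping.lookup p m * Poly_Mapping.lookup q n))"
    unfolding mult_single[symmetric] sum_product[symmetric] sum_single_keys ..
  then have "eval_rpoly (p * q) x = (\<Sum>m\<in>Poly_Mapping.keys p. \<Sum>n\<in>Poly_Mapping.keys q.
      (Poly_Mapping.lookup p m * eval_monomial m x) * (Poly_Mapping.lookup q n * eval_monomial n x))"
    by (simp add: eval_rpoly_sum eval_rpoly_single eval_monomial_add algebra_simps)
  then show ?thesis
    by (simp add: eval_rpoly_monomials sum_product)
qed

text \<open>Congruence modulo the vanishing ideal becomes equality of values on
  \<open>V\<close>.\<close>

lemma eval_sos_mod_vanishing_ideal:
  assumes "sos_mod k (vanishing_ideal V) f"
  obtains m :: nat and g where "\<And>j. j < m \<Longrightarrow> total_degree (g j) \<le> k"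
    and "\<And>x. x \<in> V \<Longrightarrow> eval_rpoly f x = (\<Sum>j<m. (eval_rpoly (g j) x)\<^sup>2)"
proof -
  obtain m :: nat and g where g: "\<forall>j<m. total_degree (g j) \<le> k"
    and I: "f - (\<Sum>j<m. (g j)\<^sup>2) \<in> vanishing_ideal V"
    using assms unfolding sos_mod_def by blast
  show ?thesis
  proof
    show "eval_rpoly f x = (\<Sum>j<m. (eval_rpoly (g j) x)\<^sup>2)" if "x \<in> V" for x
      using I that
      by (simp add: vanishing_ideal_def eval_rpoly_diff eval_rpoly_sum power2_eq_square eval_rpoly_mult)
  qed (use g in auto)
qed

lemma sum_lookup_le_total_degree:
  assumes "m \<in> Poly_Mapping.keys p"
  shows "(\<Sum>i\<in>UNIV. Poly_Mapping.lookup m i) \<le> total_degree p"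
  unfolding total_degree_def by (rule Max_ge) (use assms in auto)

text \<open>A monomial of degree at most 1 is the constant 1 or a single coordinate.\<close>

lemma eval_rpoly_affine:
  assumes "total_degree p \<le> 1"
  obtains a b where "\<And>x. eval_rpoly p x = a + b \<bullet> x"
proof -
  have "\<exists>a b. \<forall>x. eval_monomial m x = a + b \<bullet> x" if "m \<in> Poly_Mapping.keys p" for m
  proof -
    have "(\<Sum>i\<in>UNIV. Poly_Mapping.lookup m i) \<le> 1"
      using sum_lookup_le_total_degree[OF that] assms by linarith
    then consider "(\<Sum>i\<in>UNIV. Poly_Mapping.lookup m i) = 0" | "(\<Sum>i\<in>UNIV. Poly_Mapping.lookup m i) = 1"
      by linarith
    then show ?thesis
    proof cases
      case 1
      then have "eval_monomial m x = 1 + 0 \<bullet> x" for x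
        by (simp add: eval_monomial_def)
      then show ?thesis by blast
    next
      case 2
      then obtain i where i: "Poly_Mapping.lookup m i = 1" "\<And>j. j \<noteq> i \<Longrightarrow> Poly_Mapping.lookup m j = 0"
        by (subst (asm) sum_eq_1_iff) auto
      have "eval_monomial m x = (\<Prod>j\<in>UNIV. if j = i then x $ i else 1)" for x
        unfolding eval_monomial_def by (rule prod.cong) (use i in auto)
      then have "eval_monomial m x = 0 + axis i 1 \<bullet> x" for x
        by (simp add: inner_axis')
      then show ?thesis by blast
    qed
  qed
  then obtain a b where ab: "\<And>m x. m \<in> Poly_Mapping.keys p \<Longrightarrow> eval_monomial m x = a m + b m \<bullet> x"
    by metis
  have "eval_rpoly p x = (\<Sum>m\<in>Poly_Mapping.keys p. Poly_Mapping.lookup p m * a m) +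
      (\<Sum>m\<in>Poly_Mapping.keys p. Poly_Mapping.lookup p m *\<^sub>R b m) \<bullet> x" for x
    by (simp add: eval_rpoly_monomials ab inner_sum_left sum.distrib algebra_simps)
  then show ?thesis by (rule that)
qed

text \<open>An affine \<open>f\<close> that is a sum of squares on \<open>V\<close> defines a
  half-space containing \<open>V\<close>, hence its convex hull.\<close>

lemma convex_hull_subset_theta_body: "convex hull V \<subseteq> theta_body k (vanishing_ideal V)"
proof
  fix x assume x: "x \<in> convex hull V"
  show "x \<in> theta_body k (vanishing_ideal V)"
    unfolding theta_body_def
  proof (intro CollectI allI impI, elim conjE)
    fix f :: "'a rpoly"
    assume deg: "total_degree f \<le> 1" and sos: "sos_mod k (vanishing_ideal V) f"
    obtain a b where ab: "\<And>x. eval_rpoly f x = a + b \<bullet> x"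
      using eval_rpoly_affine[OF deg] by blast
    have "0 \<le> eval_rpoly f y" if "y \<in> V" for y
      using eval_sos_mod_vanishing_ideal[OF sos] that by (metis sum_nonneg zero_le_power2)
    then have "V \<subseteq> {y. b \<bullet> y \<ge> - a}"
      using ab by force
    then have "convex hull V \<subseteq> {y. b \<bullet> y \<ge> - a}"
      by (rule hull_minimal) (rule convex_halfspace_ge)
    then show "0 \<le> eval_rpoly f x"
      using x ab by force
  qed
qed

section \<open>Degree of functions of vertex sets\<close>

text \<open>The degree is that of a function on the 0/1 cube; \<open>Suc d\<close> stands for degree
  at most \<open>d\<close>.\<close>

definition set_degree_less :: "nat \<Rightarrow> ('a::finite set \<Rightarrow> real) \<Rightarrow> bool" where
  "set_degree_less d f \<longleftrightarrow> (\<exists>c. f = subset_sum d c)"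

text \<open>The index set no longer depends on \<open>T\<close>, so sums can be multiplied as
  polynomials in \<open>T\<close>.\<close>

lemma subset_sum_of_bool:
  fixes T :: "'a::finite set"
  shows "subset_sum d c T = (\<Sum>I | card I < d. c I * of_bool (I \<subseteq> T))"
  unfolding subset_sum_def by (rule sum.mono_neutral_cong_left) auto

lemma set_degree_less_of_bool:
  assumes "card I < d"
  shows "set_degree_less d (\<lambda>T. of_bool (I \<subseteq> T))"
  unfolding set_degree_less_def
proof (intro exI ext)
  fix T :: "'a set"
  have "subset_sum d (\<lambda>J. of_bool (J = I)) T = (\<Sum>J\<in>{J. card J < d}. if J = I then of_bool (I \<subseteq> T) else 0)"
    unfolding subset_sum_of_bool by (rule sum.cong) auto
  then show "of_bool (I \<subseteq> T) = subset_sum d (\<lambda>J. of_bool (J = I)) T"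
    using assms by simp
qed

lemma set_degree_less_sum:
  assumes "\<And>s. s \<in> S \<Longrightarrow> set_degree_less d (f s)"
  shows "set_degree_less d (\<lambda>T. \<Sum>s\<in>S. a s * f s T)"
proof -
  obtain c where c: "\<And>s. s \<in> S \<Longrightarrow> f s = subset_sum d (c s)"
    using assms unfolding set_degree_less_def by metis
  have "(\<Sum>s\<in>S. a s * f s T) = subset_sum d (\<lambda>I. \<Sum>s\<in>S. a s * c s I) T" for T
  proof -
    have "(\<Sum>s\<in>S. a s * f s T) = (\<Sum>s\<in>S. \<Sum>I | I \<subseteq> T \<and> card I < d. a s * c s I)"
      by (simp add: c subset_sum_def sum_distrib_left)
    also have "\<dots> = subset_sum d (\<lambda>I. \<Sum>s\<in>S. a s * c s I) T"
      unfolding subset_sum_def by (rule sum.swap)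
    finally show ?thesis .
  qed
  then show ?thesis unfolding set_degree_less_def by blast
qed

lemma set_degree_less_mono:
  assumes "set_degree_less d f" "d \<le> d'"
  shows "set_degree_less d' f"
proof -
  obtain c where c: "f = subset_sum d c"
    using assms unfolding set_degree_less_def by blast
  have "set_degree_less d' (\<lambda>T. \<Sum>I | card I < d. c I * of_bool (I \<subseteq> T))"
    by (rule set_degree_less_sum, rule set_degree_less_of_bool) (use assms in auto)
  then show ?thesis unfolding c subset_sum_of_bool[abs_def] .
qed

text \<open>The monomials of \<open>I\<close> and \<open>J\<close> multiply to that of
  \<open>I \<union> J\<close>, as indicators are idempotent.\<close>

lemma set_degree_less_mult:
  assumes "set_degree_less (Suc i) f" "set_degree_less (Suc j) g"
  shows "set_degree_less (Suc (i + j)) (\<lambda>T. f T * g T)"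
proof -
  obtain c c' where c: "f = subset_sum (Suc i) c" "g = subset_sum (Suc j) c'"
    using assms unfolding set_degree_less_def by blast
  have *: "f T * g T = (\<Sum>(I, J)\<in>{I. card I < Suc i} \<times> {J. card J < Suc j}.
      (c I * c' J) * of_bool (I \<union> J \<subseteq> T))" for T
    unfolding c subset_sum_of_bool sum_product sum.cartesian_product
    by (rule sum.cong) auto
  have "set_degree_less (Suc (i + j)) (\<lambda>T. \<Sum>s\<in>{I. card I < Suc i} \<times> {J. card J < Suc j}.
      (c (fst s) * c' (snd s)) * of_bool (fst s \<union> snd s \<subseteq> T))"
  proof (rule set_degree_less_sum, rule set_degree_less_of_bool)
    fix s :: "'a set \<times> 'a set" assume "s \<in> {I. card I < Suc i} \<times> {J. card J < Suc j}"
    then show "card (fst s \<union> snd s) < Suc (i + j)"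
      using card_Un_le[of "fst s" "snd s"] by auto
  qed
  then show ?thesis unfolding * by (simp add: case_prod_unfold)
qed

lemma set_degree_less_one: "set_degree_less (Suc 0) (\<lambda>T. 1)"
  using set_degree_less_of_bool[of "{}" "Suc 0"] by simp

lemma set_degree_less_power:
  assumes "set_degree_less (Suc i) f"
  shows "set_degree_less (Suc (i * k)) (\<lambda>T. f T ^ k)"
proof (induction k)
  case (Suc k)
  then show ?case using set_degree_less_mult[OF assms Suc] by simp
qed (simp add: set_degree_less_one)

lemma set_degree_less_prod:
  assumes "finite S" "\<And>s. s \<in> S \<Longrightarrow> set_degree_less (Suc (k s)) (f s)"
  shows "set_degree_less (Suc (\<Sum>s\<in>S. k s)) (\<lambda>T. \<Prod>s\<in>S. f s T)"
  using assms
proof (induction S rule: finite_induct)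
  case (insert s S)
  then show ?case
    using set_degree_less_mult[of "k s" "f s" "\<Sum>s\<in>S. k s" "\<lambda>T. \<Prod>s\<in>S. f s T"] by simp
qed (simp add: set_degree_less_one)

text \<open>Used with \<open>l = 2\<close>: cut indicators are quadratic in the vertex indicators,
  so degree \<open>k\<close> in the edges becomes degree \<open>2 * k\<close> in the
  vertices.\<close>

lemma set_degree_less_eval_rpoly:
  assumes "\<And>i. set_degree_less (Suc l) (\<lambda>T. h T $ i)" "total_degree p \<le> k"
  shows "set_degree_less (Suc (l * k)) (\<lambda>T. eval_rpoly p (h T))"
  unfolding eval_rpoly_monomials
proof (rule set_degree_less_sum)
  fix m assume "m \<in> Poly_Mapping.keys p"
  then have "(\<Sum>i\<in>UNIV. Poly_Mapping.lookup m i) \<le> k"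
    using sum_lookup_le_total_degree[of m p] assms(2) by linarith
  then have "(\<Sum>i\<in>UNIV. l * Poly_Mapping.lookup m i) \<le> l * k"
    unfolding sum_distrib_left[symmetric] by (rule mult_le_mono2)
  moreover have "set_degree_less (Suc (\<Sum>i\<in>UNIV. l * Poly_Mapping.lookup m i)) (\<lambda>T. eval_monomial m (h T))"
    unfolding eval_monomial_def
    by (intro set_degree_less_prod set_degree_less_power assms(1)) simp
  ultimately show "set_degree_less (Suc (l * k)) (\<lambda>T. eval_monomial m (h T))"
    using set_degree_less_mono by (meson Suc_le_mono)
qed

section \<open>Cuts and triangle free edge sets\<close>

definition cut_edges :: "'v::card2 set \<Rightarrow> 'v edge set" where
  "cut_edges T = {e. card (endpoints e \<inter> T) = 1}"

lemma endpoints_pair: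
  obtains a b where "endpoints e = {a, b}" "a \<noteq> b"
  using endpoints[of e] by (auto simp: card_2_iff)

text \<open>Two of three vertices lie on the same side of the cut, and the edge between them is not
  cut.\<close>

lemma triangle_free_cut: "triangle_free (cut_edges T)"
  unfolding triangle_free_def
proof
  assume "\<exists>u v w. u \<noteq> v \<and> v \<noteq> w \<and> u \<noteq> w \<and> {{u, v}, {v, w}, {u, w}} \<subseteq> endpoints ` cut_edges T"
  then obtain u v w where "u \<noteq> v" "v \<noteq> w" "u \<noteq> w"
    and "{u, v} \<in> endpoints ` cut_edges T" "{v, w} \<in> endpoints ` cut_edges T" "{u, w} \<in> endpoints ` cut_edges T"
    by auto
  then have "card ({u, v} \<inter> T) = 1" "card ({v, w} \<inter> T) = 1" "card ({u, w} \<inter> T) = 1"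
    by (auto simp: cut_edges_def)
  then show False
    using \<open>u \<noteq> v\<close> \<open>v \<noteq> w\<close> \<open>u \<noteq> w\<close>
    by (cases "u \<in> T"; cases "v \<in> T"; cases "w \<in> T") auto
qed

lemma set_degree_less_cut:
  "set_degree_less (Suc 2) (\<lambda>T. char_vec (cut_edges T) $ e)"
proof -
  obtain a b where ab: "endpoints e = {a, b}" "a \<noteq> b"
    by (rule endpoints_pair)
  \<comment> \<open>In terms of the vertex indicators this is
    \<open>y\<^sub>a + y\<^sub>b - 2 * y\<^sub>a * y\<^sub>b\<close>.\<close>
  have "char_vec (cut_edges T) $ e =
    (\<Sum>I\<in>{{a}, {b}, {a, b}}. (if I = {a, b} then - 2 else 1) * of_bool (I \<subseteq> T))" for T
    using ab by (cases "a \<in> T"; cases "b \<in> T") (auto simp: char_vec_def cut_edges_def doubleton_eq_iff)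
  moreover have "set_degree_less (Suc 2)
      (\<lambda>T. \<Sum>I\<in>{{a}, {b}, {a, b}}. (if I = {a, b} then - 2 else 1) * of_bool (I \<subseteq> T))"
    by (rule set_degree_less_sum, rule set_degree_less_of_bool) (use ab in auto)
  ultimately show ?thesis by simp
qed

text \<open>Delete both ends of an edge \<open>{u, v}\<close>. Without triangles every other vertex
  is adjacent to at most one of them, so at most \<open>1 + card B\<close> edges are lost, and
  \<open>(card B)\<^sup>2 + 4 * (1 + card B) = (card B + 2)\<^sup>2\<close>.\<close>

lemma mantel:
  assumes "finite A" "\<And>e. e \<in> G \<Longrightarrow> e \<subseteq> A \<and> card e = 2"
    and "\<And>u v w. u \<noteq> v \<Longrightarrow> v \<noteq> w \<Longrightarrow> u \<noteq> w \<Longrightarrow> \<not> {{u, v}, {v, w}, {u, w}} \<subseteq> G"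
  shows "4 * card G \<le> (card A)\<^sup>2"
  using assms
proof (induction "card A" arbitrary: A G rule: less_induct)
  case less
  show ?case
  proof (cases "G = {}")
    case False
    then obtain u v where uv: "{u, v} \<in> G" "u \<noteq> v"
      using less.prems(2) by (metis card_2_iff ex_in_conv)
    then have uvA: "u \<in> A" "v \<in> A" using less.prems(2) by auto
    define B where "B = A - {u, v}"
    define N where "N z = {w \<in> B. {z, w} \<in> G}" for z
    have "card {u, v} \<le> card A" using uvA less.prems(1) by (intro card_mono) auto
    then have cardA: "card A = card B + 2"
      unfolding B_def using uv(2) uvA less.prems(1) by (simp add: card_Diff_subset)
    have "finite B" using less.prems(1) by (simp add: B_def)
    have IH: "4 * card {e \<in> G. e \<subseteq> B} \<le> (card B)\<^sup>2"
    proof (rule less.hyps)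
      show "\<not> {{x, y}, {y, z}, {x, z}} \<subseteq> {e \<in> G. e \<subseteq> B}"
        if "x \<noteq> y" "y \<noteq> z" "x \<noteq> z" for x y z
        using less.prems(3)[OF that] by blast
    qed (use cardA \<open>finite B\<close> less.prems(2) in auto)
    have "N u \<inter> N v = {}"
    proof (rule ccontr)
      assume "N u \<inter> N v \<noteq> {}"
      then obtain w where "w \<in> B" "{u, w} \<in> G" "{v, w} \<in> G" by (auto simp: N_def)
      then show False using less.prems(3)[of u v w] uv by (auto simp: B_def)
    qed
    moreover have "N u \<union> N v \<subseteq> B" by (auto simp: N_def)
    ultimately have N: "card (N u) + card (N v) \<le> card B"
      using \<open>finite B\<close> by (metis card_Un_disjoint card_mono finite_Un finite_subset)
    have fin: "finite (N u)" "finite (N v)" using \<open>finite B\<close> by (auto simp: N_def)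
    have "finite G"
      by (rule finite_subset[of _ "Pow A"]) (use less.prems in auto)
    have "G \<subseteq> {e \<in> G. e \<subseteq> B} \<union> ({{u, v}} \<union> ((\<lambda>w. {u, w}) ` N u \<union> (\<lambda>w. {v, w}) ` N v))"
    proof
      fix e assume e: "e \<in> G"
      then obtain x y where xy: "e = {x, y}" "x \<noteq> y"
        using less.prems(2) by (metis card_2_iff)
      have xyA: "x \<in> A" "y \<in> A" using less.prems(2)[OF e] xy by auto
      have N: "{z, w} \<in> (\<lambda>w. {u, w}) ` N u \<union> (\<lambda>w. {v, w}) ` N v"
        if "z \<in> {u, v}" "w \<in> A" "w \<notin> {u, v}" "{z, w} \<in> G" for z w
      proof -
        have "w \<in> N z" using that by (simp add: N_def B_def)
        then show ?thesis using that(1) by blast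
      qed
      consider "x \<in> {u, v}" "y \<in> {u, v}" | "x \<in> {u, v}" "y \<notin> {u, v}" | "x \<notin> {u, v}" "y \<in> {u, v}"
        | "x \<notin> {u, v}" "y \<notin> {u, v}" by blast
      then show "e \<in> {e \<in> G. e \<subseteq> B} \<union> ({{u, v}} \<union> ((\<lambda>w. {u, w}) ` N u \<union> (\<lambda>w. {v, w}) ` N v))"
      proof cases
        case 1
        then have "e = {u, v}" using xy by auto
        then show ?thesis by simp
      next
        case 2
        then show ?thesis using N[of x y] xyA e xy(1) by simp
      next
        case 3
        then show ?thesis using N[of y x] xyA e xy(1) by (simp add: insert_commute)
      next
        case 4
        then have "e \<subseteq> B" using xyA xy(1) by (simp add: B_def)
        then show ?thesis using e by simp
      qed
    qed
    then have "card G \<le> card ({e \<in> G. e \<subseteq> B} \<union> ({{u, v}} \<union> ((\<lambda>w. {u, w}) ` N u \<union> (\<lambda>w. {v, w}) ` N v)))"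
      using fin \<open>finite G\<close> by (intro card_mono) auto
    also have "\<dots> \<le> card {e \<in> G. e \<subseteq> B} + (card {{u, v}} + (card (N u) + card (N v)))"
      by (intro card_Un_le[THEN order.trans] add_mono order.refl card_image_le fin)
    finally have "4 * card G \<le> (card B)\<^sup>2 + 4 * (1 + card B)"
      using IH N by simp
    then show ?thesis by (simp add: cardA power2_eq_square algebra_simps)
  qed simp
qed

lemma card_triangle_free_le:
  assumes "triangle_free S"
  shows "4 * card {e \<in> S. endpoints e \<subseteq> A} \<le> (card A)\<^sup>2"
proof -
  let ?G = "endpoints ` {e \<in> S. endpoints e \<subseteq> A}"
  have "4 * card ?G \<le> (card A)\<^sup>2"
  proof (rule mantel)
    have "?G \<subseteq> endpoints ` S" by auto
    then show "\<not> {{u, v}, {v, w}, {u, w}} \<subseteq> ?G" if "u \<noteq> v" "v \<noteq> w" "u \<noteq> w" for u v w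
      using assms that unfolding triangle_free_def by (meson order.trans)
  qed (use endpoints in auto)
  moreover have "card ?G = card {e \<in> S. endpoints e \<subseteq> A}"
    by (rule card_image) (simp add: inj_on_def endpoints_inject)
  ultimately show ?thesis by simp
qed

text \<open>Each cut edge inside \<open>A\<close> has one end in \<open>T\<close> and the other in
  \<open>A - T\<close>, which orders its endpoints uniquely.\<close>

lemma card_cut_within:
  assumes "T \<subseteq> A"
  shows "card {e \<in> cut_edges T. endpoints e \<subseteq> A} = card T * (card A - card T)"
proof -
  have "endpoints ` {e \<in> cut_edges T. endpoints e \<subseteq> A} = (\<lambda>(a, b). {a, b}) ` (T \<times> (A - T))" (is "?L = ?R")
  proof
    show "?L \<subseteq> ?R"
    proof
      fix s assume "s \<in> ?L"
      then obtain e where e: "s = endpoints e" "card (s \<inter> T) = 1" "s \<subseteq> A" by (auto simp: cut_edges_def)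
      obtain a b where ab: "s = {a, b}" "a \<noteq> b" using e(1) endpoints_pair by metis
      show "s \<in> ?R"
      proof (cases "a \<in> T")
        case True
        then have "b \<notin> T" using e(2) ab by auto
        then show ?thesis using True ab e(3) by auto
      next
        case False
        then have "b \<in> T" using e(2) ab by (cases "b \<in> T") auto
        then have "(b, a) \<in> T \<times> (A - T)" "s = {b, a}" using False ab e(3) by auto
        then show ?thesis by (metis (no_types, lifting) case_prod_conv image_eqI)
      qed
    qed
    show "?R \<subseteq> ?L"
    proof
      fix s assume "s \<in> ?R"
      then obtain a b where ab: "s = {a, b}" "a \<in> T" "b \<in> A" "b \<notin> T" by auto
      then have "endpoints (Edge s) = s" by (intro Edge_inverse) (auto simp: card_2_iff)
      moreover have "card (s \<inter> T) = 1" using ab by auto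
      ultimately have "Edge s \<in> {e \<in> cut_edges T. endpoints e \<subseteq> A}"
        using ab assms by (auto simp: cut_edges_def)
      then show "s \<in> ?L" using \<open>endpoints (Edge s) = s\<close> by (metis imageI)
    qed
  qed
  moreover have "inj_on (\<lambda>(a, b). {a, b}) (T \<times> (A - T))"
    by (auto simp: inj_on_def doubleton_eq_iff)
  moreover have "inj_on endpoints {e \<in> cut_edges T. endpoints e \<subseteq> A}"
    by (simp add: inj_on_def endpoints_inject)
  ultimately have "card {e \<in> cut_edges T. endpoints e \<subseteq> A} = card (T \<times> (A - T))"
    by (simp add: card_image flip: card_image[of endpoints])
  then show ?thesis
    using assms by (simp add: card_cartesian_product card_Diff_subset)
qed

lemma inner_char_vec: "char_vec E \<bullet> char_vec S = real (card {e \<in> S. e \<in> E})"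
proof -
  have "char_vec E \<bullet> char_vec S = (\<Sum>e\<in>UNIV. of_bool (e \<in> S \<and> e \<in> E))"
    unfolding inner_vec_def char_vec_def by (rule sum.cong) auto
  then show ?thesis by (simp only: sum_of_bool_eq finite_UNIV) simp
qed

section \<open>The separating point\<close>

theorem theorem4p1:
  fixes n k :: nat
  assumes "CARD('v::card2) = n"
    and "n > 0" and "k > 0"
    and "real k < (real n - 2) / 4"
  shows "(P3 :: (real ^ 'v edge) set) \<subset> theta_body k (vanishing_ideal triangle_free_points)"
proof -
  \<comment> \<open>The hypothesis says \<open>4 * k + 2 < n\<close>. The size
    \<open>4 * k + 3\<close> is odd, so Mantel's bound for it is not an integer.\<close>
  have "4 * k + 3 \<le> CARD('v)" using assms by simp
  then obtain A :: "'v set" where A: "card A = 4 * k + 3"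
    by (metis obtain_subset_with_card_n)
  define r where "r = real (card A) / 2"
  define wt where "wt T = knapsack_weight (card A) r (card T) / fact (card A)" for T :: "'v set"
  \<comment> \<open>An affine combination of cut vectors: the weights sum to 1 but need not be
    nonnegative, so \<open>z\<close> may leave the convex hull.\<close>
  define z where "z = (\<Sum>T\<in>Pow A. wt T *\<^sub>R char_vec (cut_edges T))"
  have wt: "(\<Sum>T\<in>Pow A. wt T * f T) = knapsack_sum A r f / fact (card A)" for f
    by (simp add: wt_def knapsack_sum_def sum_divide_distrib)
  have "knapsack_sum A r (\<lambda>T. 1) = fact (card A)"
    using knapsack_sum_poly_card[of A "[:1:]" "\<lambda>T. 1" r] by simp
  then have wt_1: "(\<Sum>T\<in>Pow A. wt T) = 1" using wt[of "\<lambda>T. 1"] by simp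
  have inner_z: "b \<bullet> z = (\<Sum>T\<in>Pow A. wt T * (b \<bullet> char_vec (cut_edges T)))" for b
    by (simp add: z_def inner_sum_right)
  have "z \<in> theta_body k (vanishing_ideal triangle_free_points)"
    unfolding theta_body_def
  proof (intro CollectI allI impI, elim conjE)
    fix f :: "'v edge rpoly"
    assume deg: "total_degree f \<le> 1" and sos: "sos_mod k (vanishing_ideal triangle_free_points) f"
    obtain a b where ab: "\<And>x. eval_rpoly f x = a + b \<bullet> x"
      using eval_rpoly_affine[OF deg] by blast
    obtain m :: nat and g where g: "\<And>j. j < m \<Longrightarrow> total_degree (g j) \<le> k"
      and fg: "\<And>x. x \<in> triangle_free_points \<Longrightarrow> eval_rpoly f x = (\<Sum>j<m. (eval_rpoly (g j) x)\<^sup>2)"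
      using eval_sos_mod_vanishing_ideal[OF sos] by blast
    have cut_point: "char_vec (cut_edges T) \<in> triangle_free_points" for T :: "'v set"
      by (auto simp: triangle_free_points_def triangle_free_cut)
    have "eval_rpoly f z = (\<Sum>T\<in>Pow A. wt T * a) + (\<Sum>T\<in>Pow A. wt T * (b \<bullet> char_vec (cut_edges T)))"
      unfolding ab inner_z sum_distrib_right[symmetric] wt_1 by simp
    also have "\<dots> = (\<Sum>T\<in>Pow A. wt T * eval_rpoly f (char_vec (cut_edges T)))"
      by (simp add: ab sum.distrib algebra_simps)
    also have "\<dots> = (\<Sum>T\<in>Pow A. \<Sum>j<m. wt T * (eval_rpoly (g j) (char_vec (cut_edges T)))\<^sup>2)"
      by (simp add: fg[OF cut_point] sum_distrib_left)
    also have "\<dots> = (\<Sum>j<m. \<Sum>T\<in>Pow A. wt T * (eval_rpoly (g j) (char_vec (cut_edges T)))\<^sup>2)"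
      by (rule sum.swap)
    also have "\<dots> \<ge> 0"
    proof (rule sum_nonneg)
      fix j assume "j \<in> {..<m}"
      then have "set_degree_less (Suc (2 * k)) (\<lambda>T :: 'v set. eval_rpoly (g j) (char_vec (cut_edges T)))"
        by (intro set_degree_less_eval_rpoly set_degree_less_cut g) simp
      then obtain c where c: "(\<lambda>T :: 'v set. eval_rpoly (g j) (char_vec (cut_edges T))) = subset_sum (Suc (2 * k)) c"
        by (auto simp: set_degree_less_def)
      have "0 \<le> knapsack_sum A r (\<lambda>T. (subset_sum (Suc (2 * k)) c T)\<^sup>2)"
        \<comment> \<open>Both bounds read \<open>2 * k + 1 \<le> (4 * k + 3) / 2\<close>.\<close>
        by (rule knapsack_sum_square_nonneg) (simp_all add: r_def A field_simps)
      then show "0 \<le> (\<Sum>T\<in>Pow A. wt T * (eval_rpoly (g j) (char_vec (cut_edges T)))\<^sup>2)"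
        unfolding wt c[symmetric] by simp
    qed
    finally show "0 \<le> eval_rpoly f z" .
  qed
  moreover have "z \<notin> P3"
  proof
    let ?b = "char_vec {e. endpoints e \<subseteq> A} :: real ^ 'v edge"
    assume "z \<in> P3"
    have nat_le: "a \<le> b" if "4 * a \<le> 4 * b + 1" for a b :: nat
      using that by linarith
    \<comment> \<open>The bound is Mantel's, rounded down:
      \<open>(4 * k + 3)\<^sup>2 = 4 * (4 * k\<^sup>2 + 6 * k + 2) + 1\<close>.\<close>
    have "?b \<bullet> x \<le> real (4 * k\<^sup>2 + 6 * k + 2)" if x: "x \<in> triangle_free_points" for x
    proof -
      obtain S where S: "triangle_free S" "x = char_vec S"
        using x by (auto simp: triangle_free_points_def)
      have "4 * card {e \<in> S. endpoints e \<subseteq> A} \<le> 4 * (4 * k\<^sup>2 + 6 * k + 2) + 1"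
        using card_triangle_free_le[OF S(1), of A] unfolding A by (simp add: power2_eq_square algebra_simps)
      then have "card {e \<in> S. endpoints e \<subseteq> A} \<le> 4 * k\<^sup>2 + 6 * k + 2"
        by (rule nat_le)
      then show ?thesis unfolding S(2) inner_char_vec of_nat_le_iff by simp
    qed
    then have "P3 \<subseteq> {x. ?b \<bullet> x \<le> real (4 * k\<^sup>2 + 6 * k + 2)}"
      unfolding P3_def by (intro hull_minimal convex_halfspace_le) auto
    then have "?b \<bullet> z \<le> real (4 * k\<^sup>2 + 6 * k + 2)"
      using \<open>z \<in> P3\<close> by auto
    moreover have "?b \<bullet> z = r * (real (card A) - r)"
    proof -
      \<comment> \<open>A cut by \<open>t\<close> vertices of \<open>A\<close> has
        \<open>t * (card A - t)\<close> edges inside \<open>A\<close>, a quadratic in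
        \<open>t\<close>.\<close>
      have "knapsack_sum A r (\<lambda>T. ?b \<bullet> char_vec (cut_edges T)) = fact (card A) * poly [:0, real (card A), -1:] r"
      proof (rule knapsack_sum_poly_card)
        fix T assume T: "T \<subseteq> A"
        then have "card T \<le> card A" by (simp add: card_mono)
        then show "?b \<bullet> char_vec (cut_edges T) = poly [:0, real (card A), -1:] (real (card T))"
          using card_cut_within[OF T] by (simp add: inner_char_vec of_nat_diff algebra_simps)
      qed (simp_all add: A)
      then have "?b \<bullet> z = poly [:0, real (card A), -1:] r" unfolding inner_z wt by simp
      then show ?thesis by (simp add: algebra_simps)
    qed
    \<comment> \<open>At \<open>r = card A / 2\<close> the weight is
      \<open>(card A)\<^sup>2 / 4\<close>, which exceeds the rounded bound by
      \<open>1 / 4\<close>.\<close>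
    ultimately show False
      by (simp add: r_def A power2_eq_square field_simps)
  qed
  ultimately show ?thesis
    using convex_hull_subset_theta_body[of triangle_free_points k] unfolding P3_def by blast
qed

end
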